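(* If a hypersequent has a CAN-free derivation in $\mathbf{HR}$, then it has a derivation in $\mathbf{HR}$ that is both CAN-free and M-free.
   Context: Terms. Fix a countable set of variables $x,y,z,\dots$. Terms (in negation normal form) are generated by $A ::= x \mid \overline{x} \mid 0 \mid A+A \mid rA \mid A\sqcup A \mid A\sqcap A$, where $x$ is a variable, $\overline{x}$ is the corresponding negated variable, and $r\in\mathbb{R}_{>0}$. The negation $\overline{A}$ of a term is defined by $\overline{x}$ (for $x$), $\overline{\overline{x}}=x$, $\overline{0}=0$, $\overline{A+B}=\overline{A}+\overline{B}$, $\overline{rA}=r\overline{A}$, $\overline{A\sqcup B}=\overline{A}\sqcap\overline{B}$, $\overline{A\sqcap B}=\overline{A}\sqcup\overline{B}$. A weighted term is $r.A$ with $r\in\mathbb{R}_{>0}$; a sequent $\vdash\Gamma$ has $\Gamma$ a finite (possibly empty) multiset of weighted terms; a hypersequent is a nonempty finite multiset of sequents, written $\vdash\Gamma_1\mid\cdots\mid\vdash\Gamma_n$, and $G\mid\vdash\Gamma$ denotes the hypersequent $G$ with the sequent $\vdash\Gamma$ added. For a finite (possibly empty) sequence $\vec r=(r_1,\dots,r_n)$ of strictly positive reals, $\vec r.A$ is the multiset $r_1.A,\dots,r_n.A$, $\sum\vec r=r_1+\dots+r_n$, and $s\vec r=(sr_1,\dots,sr_n)$; for $s>0$, $s.\Gamma$ multiplies every weight in $\Gamma$ by $s$. The calculus $\mathbf{HR}$ has the rules (vectors are finite sequences of strictly positive reals): INIT: the hypersequent $\vdash$ (one empty sequent) with no premises. W: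 from $G$ infer $G\mid\vdash\Gamma$. C: from $G\mid\vdash\Gamma\mid\vdash\Gamma$ infer $G\mid\vdash\Gamma$. S: from $G\mid\vdash\Gamma_1,\Gamma_2$ infer $G\mid\vdash\Gamma_1\mid\vdash\Gamma_2$. M: from $G\mid\vdash\Gamma_1$ and $G\mid\vdash\Gamma_2$ infer $G\mid\vdash\Gamma_1,\Gamma_2$. T: for $r>0$, from $G\mid\vdash r.\Gamma$ infer $G\mid\vdash\Gamma$. ID: if $\sum\vec r=\sum\vec s$, from $G\mid\vdash\Gamma$ infer $G\mid\vdash\Gamma,\vec r.x,\vec s.\overline{x}$ ($x$ a variable). 0: from $G\mid\vdash\Gamma$ infer $G\mid\vdash\Gamma,\vec r.0$. $+$: from $G\mid\vdash\Gamma,\vec r.A,\vec r.B$ infer $G\mid\vdash\Gamma,\vec r.(A+B)$. $\times$: from $G\mid\vdash\Gamma,(s\vec r).A$ infer $G\mid\vdash\Gamma,\vec r.(sA)$. $\sqcup$: from $G\mid\vdash\Gamma,\vec r.A\mid\vdash\Gamma,\vec r.B$ infer $G\mid\vdash\Gamma,\vec r.(A\sqcup B)$. $\sqcap$: from $G\mid\vdash\Gamma,\vec r.A$ and $G\mid\vdash\Gamma,\vec r.B$ infer $G\mid\vdash\Gamma,\vec r.(A\sqcap B)$. CAN: if $\sum\vec r=\sum\vec s$, from $G\mid\vdash\Gamma,\vec s.A,\vec r.\overline{A}$ infer $G\mid\vdash\Gamma$. A derivation is a finite tree of rule instances whose leaves are INIT; it is CAN-free (resp. M-free) if it contains no instance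 of CAN (resp. M). *)

theory Defs
  imports Complex_Main "HOL-Library.Multiset" "HOL-Library.Countable"
begin

typedef posreal = "{r :: real. 0 < r}"
  morphisms real_of_posreal Abs_posreal
  by (rule exI[of _ 1]) simp

setup_lifting type_definition_posreal

instantiation posreal :: times
begin

lift_definition times_posreal :: "posreal \<Rightarrow> posreal \<Rightarrow> posreal" is "(*)"
  by simp

instance ..

end


datatype 'v rterm =
    Var 'v
  | NegVar 'v
  | Zero
  | Plus "'v rterm" "'v rterm"
  | Scale posreal "'v rterm"
  | Join "'v rterm" "'v rterm"
  | Meet "'v rterm" "'v rterm"

primrec neg :: "'v rterm \<Rightarrow> 'v rterm" where
  "neg (Var x) = NegVar x"
| "neg (NegVar x) = Var x"
| "neg Zero = Zero"
| "neg (Plus A B) = Plus (neg A) (neg B)"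
| "neg (Scale r A) = Scale r (neg A)"
| "neg (Join A B) = Meet (neg A) (neg B)"
| "neg (Meet A B) = Join (neg A) (neg B)"

type_synonym 'v weighted = "posreal \<times> 'v rterm"

type_synonym 'v sequent = "'v weighted multiset"

text \<open>
  Hypersequents are nonempty. The type does not enforce this, but the rules do: see
  \<open>rule_instance_nonempty\<close> and \<open>derivation_nonempty\<close> below.
\<close>
type_synonym 'v hypersequent = "'v sequent multiset"

definition weigh :: "posreal list \<Rightarrow> 'v rterm \<Rightarrow> 'v sequent" where
  "weigh rs A = mset (map (\<lambda>r. (r, A)) rs)"

definition total :: "posreal list \<Rightarrow> real" where
  "total rs = sum_list (map real_of_posreal rs)"

definition scale_sequent :: "posreal \<Rightarrow> 'v sequent \<Rightarrow> 'v sequent" where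
  "scale_sequent s \<Gamma> = image_mset (\<lambda>(r, A). (s * r, A)) \<Gamma>"


datatype hr_rule =
  R_INIT | R_W | R_C | R_S | R_M | R_T | R_ID | R_zero | R_plus | R_times | R_join | R_meet | R_CAN

text \<open>
  \<open>rule_instance \<rho> Hs H\<close>: the rule \<open>\<rho>\<close> has an instance with list of premises \<open>Hs\<close> and
  conclusion \<open>H\<close>. The hypersequent \<open>G | \<turnstile> \<Gamma>\<close> is \<open>add_mset \<Gamma> G\<close>. As usual for hypersequent
  calculi the side hypersequent \<open>G\<close> may be empty, except in W, where \<open>G\<close> by itself is the premise.
\<close>
inductive rule_instance ::
  "hr_rule \<Rightarrow> 'v hypersequent list \<Rightarrow> 'v hypersequent \<Rightarrow> bool" where
  INIT: "rule_instance R_INIT [] {#{#}#}"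
| W: "G \<noteq> {#} \<Longrightarrow> rule_instance R_W [G] (add_mset \<Gamma> G)"
| C: "rule_instance R_C [add_mset \<Gamma> (add_mset \<Gamma> G)] (add_mset \<Gamma> G)"
| S: "rule_instance R_S [add_mset (\<Gamma>1 + \<Gamma>2) G] (add_mset \<Gamma>1 (add_mset \<Gamma>2 G))"
| M: "rule_instance R_M [add_mset \<Gamma>1 G, add_mset \<Gamma>2 G] (add_mset (\<Gamma>1 + \<Gamma>2) G)"
| T: "rule_instance R_T [add_mset (scale_sequent r \<Gamma>) G] (add_mset \<Gamma> G)"
| ID: "total rs = total ss \<Longrightarrow>
    rule_instance R_ID [add_mset \<Gamma> G]
      (add_mset (\<Gamma> + weigh rs (Var x) + weigh ss (NegVar x)) G)"
| zero: "rule_instance R_zero [add_mset \<Gamma> G] (add_mset (\<Gamma> + weigh rs Zero) G)"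
| plus: "rule_instance R_plus [add_mset (\<Gamma> + weigh rs A + weigh rs B) G]
    (add_mset (\<Gamma> + weigh rs (Plus A B)) G)"
| times: "rule_instance R_times [add_mset (\<Gamma> + weigh (map ((*) s) rs) A) G]
    (add_mset (\<Gamma> + weigh rs (Scale s A)) G)"
| join: "rule_instance R_join
    [add_mset (\<Gamma> + weigh rs A) (add_mset (\<Gamma> + weigh rs B) G)]
    (add_mset (\<Gamma> + weigh rs (Join A B)) G)"
| meet: "rule_instance R_meet
    [add_mset (\<Gamma> + weigh rs A) G, add_mset (\<Gamma> + weigh rs B) G]
    (add_mset (\<Gamma> + weigh rs (Meet A B)) G)"
| CAN: "total rs = total ss \<Longrightarrow>
    rule_instance R_CAN [add_mset (\<Gamma> + weigh ss A + weigh rs (neg A)) G] (add_mset \<Gamma> G)"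

text \<open>
  Trees whose nodes carry a rule name and a hypersequent. In a derivation every node is a rule
  instance; the leaves are then instances of INIT, the only rule without premises.
\<close>
datatype 'v tree = Node hr_rule (conclusion: "'v hypersequent") "'v tree list"

fun derivation :: "'v tree \<Rightarrow> bool" where
  "derivation (Node \<rho> H ds) \<longleftrightarrow>
     rule_instance \<rho> (map conclusion ds) H \<and> (\<forall>d \<in> set ds. derivation d)"

fun rules_of :: "'v tree \<Rightarrow> hr_rule set" where
  "rules_of (Node \<rho> H ds) = insert \<rho> (\<Union>d \<in> set ds. rules_of d)"

definition CAN_free :: "'v tree \<Rightarrow> bool" where
  "CAN_free d \<longleftrightarrow> R_CAN \<notin> rules_of d"

definition M_free :: "'v tree \<Rightarrow> bool" where
  "M_free d \<longleftrightarrow> R_M \<notin> rules_of d"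

lemma rule_instance_nonempty:
  assumes "rule_instance \<rho> Hs H"
  shows "H \<noteq> {#}" and "\<forall>H' \<in> set Hs. H' \<noteq> {#}"
  using assms by (induction rule: rule_instance.induct) auto

lemma derivation_nonempty:
  assumes "derivation d"
  shows "conclusion d \<noteq> {#}"
  using assms by (cases d) (auto dest: rule_instance_nonempty(1))

end

theory Submission imports Defs begin

text \<open>
  M is admissible in the calculus without M and CAN. Given M-free derivations of \<open>G | \<turnstile> \<Gamma>\<close> and
  \<open>G | \<turnstile> \<Delta>\<close>, add weighted copies \<open>r\<^sub>1.\<Delta>, \<dots>, r\<^sub>k.\<Delta>\<close> to the sequents of the first derivation, starting
  from \<open>\<Gamma>, 1.\<Delta>\<close> at the root and going upwards; S concatenates the vectors of weights and T rescales
  them. A leaf then becomes \<open>G | \<turnstile> r\<^sub>1.\<Delta>, \<dots>, r\<^sub>k.\<Delta>\<close>. Since the logical rules act on vectors of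
  weights, the second derivation can be multiplied throughout by \<open>(r\<^sub>1, \<dots>, r\<^sub>k)\<close>; afterwards the
  side hypersequent is restored by S, T and C.
\<close>

instantiation posreal :: comm_monoid_mult
begin

lift_definition one_posreal :: posreal is 1
  by simp

instance
  by standard (transfer; simp)+

end

lemma real_of_posreal_times: "real_of_posreal (r * s) = real_of_posreal r * real_of_posreal s"
  by transfer simp

section \<open>Derivability without a given set of rules\<close>

text \<open>Hypersequents rather than trees allow plain rule induction, and the set \<open>R\<close>
  of forbidden rules lets one predicate cover both CAN-free and CAN-free M-free
  derivability.\<close>

inductive derivable :: "hr_rule set \<Rightarrow> 'v hypersequent \<Rightarrow> bool" for R where
  step: "rule_instance \<rho> Hs H \<Longrightarrow> \<rho> \<notin> R \<Longrightarrow> \<forall>H' \<in> set Hs. derivable R H' \<Longrightarrow> derivable R H"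

lemma derivable_if_derivation:
  "derivation d \<Longrightarrow> rules_of d \<inter> R = {} \<Longrightarrow> derivable R (conclusion d)"
proof (induction d)
  case (Node \<rho> H ds)
  have "\<forall>H' \<in> set (map conclusion ds). derivable R H'"
    using Node by fastforce
  then show ?case
    using Node.prems derivable.step[of \<rho> "map conclusion ds" H R] by simp
qed

lemma derivation_if_derivable:
  "derivable R H \<Longrightarrow> \<exists>d. derivation d \<and> conclusion d = H \<and> rules_of d \<inter> R = {}"
proof (induction rule: derivable.induct)
  case (step \<rho> Hs H)
  \<comment> \<open>\<open>f\<close> chooses one tree per premise, so equal premises share a
    subtree.\<close>
  then obtain f where f: "\<forall>H' \<in> set Hs. derivation (f H') \<and> conclusion (f H') = H' \<and> rules_of (f H') \<inter> R = {}"
    by metis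
  then have "map conclusion (map f Hs) = Hs"
    by (simp add: map_idI)
  then have "derivation (Node \<rho> H (map f Hs)) \<and> conclusion (Node \<rho> H (map f Hs)) = H
      \<and> rules_of (Node \<rho> H (map f Hs)) \<inter> R = {}"
    using f step.hyps by (auto simp del: map_map)
  then show ?case
    by blast
qed

lemma derivable_iff:
  "derivable R H \<longleftrightarrow> (\<exists>d. derivation d \<and> conclusion d = H \<and> rules_of d \<inter> R = {})"
  using derivable_if_derivation derivation_if_derivable by blast

abbreviation M_CAN_free_derivable :: "'v hypersequent \<Rightarrow> bool" (\<open>\<tturnstile> _\<close> [50] 50) where
  "\<tturnstile> H \<equiv> derivable {R_M, R_CAN} H"

lemma derivable_nonempty: "derivable R H \<Longrightarrow> H \<noteq> {#}"
  by (auto elim: derivable.cases dest: rule_instance_nonempty(1))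

lemma derivable_INIT: "\<tturnstile> {#{#}#}"
  by (rule derivable.step[OF rule_instance.INIT]) auto

lemma derivable_W: "\<tturnstile> G \<Longrightarrow> \<tturnstile> add_mset \<Gamma> G"
  by (rule derivable.step[OF rule_instance.W]) (auto dest: derivable_nonempty)

lemma derivable_C: "\<tturnstile> add_mset \<Gamma> (add_mset \<Gamma> G) \<Longrightarrow> \<tturnstile> add_mset \<Gamma> G"
  by (rule derivable.step[OF rule_instance.C]) auto

lemma derivable_S: "\<tturnstile> add_mset (\<Gamma>1 + \<Gamma>2) G \<Longrightarrow> \<tturnstile> add_mset \<Gamma>1 (add_mset \<Gamma>2 G)"
  by (rule derivable.step[OF rule_instance.S]) auto

lemma derivable_T: "\<tturnstile> add_mset (scale_sequent r \<Gamma>) G \<Longrightarrow> \<tturnstile> add_mset \<Gamma> G"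
  by (rule derivable.step[OF rule_instance.T]) auto

lemma derivable_ID:
  "\<tturnstile> add_mset \<Gamma> G \<Longrightarrow> total rs = total ss
    \<Longrightarrow> \<tturnstile> add_mset (\<Gamma> + weigh rs (Var x) + weigh ss (NegVar x)) G"
  by (rule derivable.step[OF rule_instance.ID]) auto

lemma derivable_zero: "\<tturnstile> add_mset \<Gamma> G \<Longrightarrow> \<tturnstile> add_mset (\<Gamma> + weigh rs Zero) G"
  by (rule derivable.step[OF rule_instance.zero]) auto

lemma derivable_plus:
  "\<tturnstile> add_mset (\<Gamma> + weigh rs A + weigh rs B) G \<Longrightarrow> \<tturnstile> add_mset (\<Gamma> + weigh rs (Plus A B)) G"
  by (rule derivable.step[OF rule_instance.plus]) auto

lemma derivable_times:
  "\<tturnstile> add_mset (\<Gamma> + weigh (map ((*) s) rs) A) G \<Longrightarrow> \<tturnstile> add_mset (\<Gamma> + weigh rs (Scale s A)) G"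
  by (rule derivable.step[OF rule_instance.times]) auto

lemma derivable_join:
  "\<tturnstile> add_mset (\<Gamma> + weigh rs A) (add_mset (\<Gamma> + weigh rs B) G)
    \<Longrightarrow> \<tturnstile> add_mset (\<Gamma> + weigh rs (Join A B)) G"
  by (rule derivable.step[OF rule_instance.join]) auto

lemma derivable_meet:
  "\<tturnstile> add_mset (\<Gamma> + weigh rs A) G \<Longrightarrow> \<tturnstile> add_mset (\<Gamma> + weigh rs B) G
    \<Longrightarrow> \<tturnstile> add_mset (\<Gamma> + weigh rs (Meet A B)) G"
  by (rule derivable.step[OF rule_instance.meet]) auto

lemma derivable_weaken: "\<tturnstile> H \<Longrightarrow> \<tturnstile> K + H"
  by (induction K) (auto intro: derivable_W)

text \<open>C acts on one sequent at a time; generalising \<open>K\<close> lets it collect the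
  sequents already contracted.\<close>

lemma derivable_contract: "\<tturnstile> G + G + K \<Longrightarrow> \<tturnstile> G + K"
proof (induction G arbitrary: K)
  case (add \<Gamma> G)
  then have "\<tturnstile> add_mset \<Gamma> (add_mset \<Gamma> (G + G + K))"
    by simp
  then have "\<tturnstile> G + G + add_mset \<Gamma> K"
    by (simp add: derivable_C[of \<Gamma> "G + G + K"])
  then have "\<tturnstile> G + add_mset \<Gamma> K"
    by (rule add.IH)
  then show ?case
    by simp
qed simp

section \<open>Multiplying a sequent by a vector of weights\<close>

definition copies :: "posreal list \<Rightarrow> 'v sequent \<Rightarrow> 'v sequent" where
  "copies vs \<Gamma> = (\<Sum>v\<leftarrow>vs. scale_sequent v \<Gamma>)"

definition mult_vec :: "posreal list \<Rightarrow> posreal list \<Rightarrow> posreal list" where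
  "mult_vec vs rs = concat (map (\<lambda>v. map ((*) v) rs) vs)"

lemma scale_sequent_plus [simp]:
  "scale_sequent s (\<Gamma> + \<Delta>) = scale_sequent s \<Gamma> + scale_sequent s \<Delta>"
  by (simp add: scale_sequent_def)

lemma scale_sequent_empty [simp]: "scale_sequent s {#} = {#}"
  by (simp add: scale_sequent_def)

lemma scale_sequent_one [simp]: "scale_sequent 1 \<Gamma> = \<Gamma>"
  by (simp add: scale_sequent_def)

lemma scale_sequent_scale:
  "scale_sequent r (scale_sequent s \<Gamma>) = scale_sequent (r * s) \<Gamma>"
  by (simp add: scale_sequent_def multiset.map_comp comp_def case_prod_unfold mult.assoc)

lemma scale_sequent_weigh: "scale_sequent s (weigh rs A) = weigh (map ((*) s) rs) A"
  by (simp add: scale_sequent_def weigh_def multiset.map_comp comp_def flip: mset_map)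

lemma copies_Nil [simp]: "copies [] \<Gamma> = {#}"
  by (simp add: copies_def)

lemma copies_Cons [simp]: "copies (v # vs) \<Gamma> = scale_sequent v \<Gamma> + copies vs \<Gamma>"
  by (simp add: copies_def)

lemma copies_append [simp]: "copies (vs @ ws) \<Gamma> = copies vs \<Gamma> + copies ws \<Gamma>"
  by (simp add: copies_def)

lemma copies_empty [simp]: "copies vs {#} = {#}"
  by (induction vs) auto

lemma copies_plus [simp]: "copies vs (\<Gamma> + \<Delta>) = copies vs \<Gamma> + copies vs \<Delta>"
  by (induction vs) auto

lemma copies_map_times: "copies (map ((*) r) vs) \<Gamma> = scale_sequent r (copies vs \<Gamma>)"
  by (induction vs) (auto simp: scale_sequent_scale)

lemma copies_scale: "copies vs (scale_sequent r \<Gamma>) = scale_sequent r (copies vs \<Gamma>)"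
  by (induction vs) (auto simp: scale_sequent_scale mult.commute)

lemma weigh_append: "weigh (rs @ ss) A = weigh rs A + weigh ss A"
  by (simp add: weigh_def)

text \<open>The multiplied principal formulas form a single vector again, so one instance of a
  logical rule treats all of them at once.\<close>

lemma copies_weigh: "copies vs (weigh rs A) = weigh (mult_vec vs rs) A"
  by (induction vs) (auto simp: mult_vec_def scale_sequent_weigh weigh_append, simp add: weigh_def)

text \<open>Multiplicativity preserves the side condition of ID.\<close>

lemma total_mult_vec: "total (mult_vec vs rs) = total vs * total rs"
  by (induction vs)
    (auto simp: mult_vec_def total_def real_of_posreal_times comp_def sum_list_const_mult distrib_right)

lemma mult_vec_map_times: "mult_vec vs (map ((*) s) rs) = map ((*) s) (mult_vec vs rs)"
  by (simp add: mult_vec_def map_concat comp_def mult.left_commute)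

section \<open>Multiplying a derivation by a vector of weights\<close>

text \<open>Each rule except M and CAN becomes an instance of the same rule with multiplied vectors.
  For empty \<open>vs\<close> all sequents become empty, and the argument still goes
  through.\<close>

lemma derivable_copies: "\<tturnstile> H \<Longrightarrow> \<tturnstile> image_mset (copies vs) H"
proof (induction rule: derivable.induct)
  case (step \<rho> Hs H)
  have IH: "\<forall>H' \<in> set Hs. \<tturnstile> image_mset (copies vs) H'"
    using step.IH by blast
  from step.hyps(1) show ?case
  proof cases
    case (T r \<Gamma> G)
    then show ?thesis
      using IH derivable_T[of r "copies vs \<Gamma>"] by (simp add: copies_scale)
  next
    case (ID rs ss \<Gamma> G x)
    then show ?thesis
      using IH derivable_ID[of "copies vs \<Gamma>" _ "mult_vec vs rs" "mult_vec vs ss"]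
      by (simp add: copies_weigh total_mult_vec)
  next
    case (times \<Gamma> s rs A G)
    then show ?thesis
      using IH derivable_times[of "copies vs \<Gamma>" s "mult_vec vs rs"] by (simp add: copies_weigh mult_vec_map_times)
  next
    case (C \<Gamma> G)
    then show ?thesis
      using IH derivable_C[of "copies vs \<Gamma>"] by simp
  next
    case (S \<Gamma>1 \<Gamma>2 G)
    then show ?thesis
      using IH derivable_S[of "copies vs \<Gamma>1" "copies vs \<Gamma>2"] by simp
  next
    case (join \<Gamma> rs A B G)
    then show ?thesis
      using IH derivable_join[of "copies vs \<Gamma>" "mult_vec vs rs"] by (simp add: copies_weigh)
  \<comment> \<open>Besides the direct cases, this discharges M and CAN, which are forbidden
    rules.\<close>
  qed (use IH step.hyps(2) in \<open>simp_all add: copies_weigh derivable_INIT derivable_W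
      derivable_zero derivable_plus derivable_meet\<close>)
qed

text \<open>S splits off one scaled copy at a time, T resets it to \<open>\<Gamma>\<close>, and C
  merges the results. The form \<open>v # vs\<close> matters: an empty vector leaves only an empty
  sequent, from which \<open>\<Gamma>\<close> cannot be recovered.\<close>

lemma derivable_uncopy: "\<tturnstile> add_mset (copies (v # vs) \<Gamma>) G \<Longrightarrow> \<tturnstile> add_mset \<Gamma> G"
proof (induction vs arbitrary: v G)
  case Nil
  then show ?case
    using derivable_T[of v \<Gamma> G] by simp
next
  case (Cons w ws)
  then have "\<tturnstile> add_mset (scale_sequent v \<Gamma>) (add_mset (copies (w # ws) \<Gamma>) G)"
    using derivable_S[of "scale_sequent v \<Gamma>" "copies (w # ws) \<Gamma>" G] by simp
  then have "\<tturnstile> add_mset (copies (w # ws) \<Gamma>) (add_mset \<Gamma> G)"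
    by (subst add_mset_commute) (rule derivable_T)
  then have "\<tturnstile> add_mset \<Gamma> (add_mset \<Gamma> G)"
    by (rule Cons.IH)
  then show ?case
    by (rule derivable_C)
qed

text \<open>\<open>K\<close> collects the sequents already restored.\<close>

lemma derivable_uncopy_all: "\<tturnstile> image_mset (copies (v # vs)) G + K \<Longrightarrow> \<tturnstile> G + K"
proof (induction G arbitrary: K)
  case (add \<Gamma> G)
  then have "\<tturnstile> add_mset \<Gamma> (image_mset (copies (v # vs)) G + K)"
    using derivable_uncopy[of v vs \<Gamma>] by (simp del: copies_Cons)
  then have "\<tturnstile> G + add_mset \<Gamma> K"
    using add.IH[of "add_mset \<Gamma> K"] by (simp del: copies_Cons)
  then show ?case
    by simp
qed simp

lemma derivable_add_copies:
  assumes "\<tturnstile> add_mset \<Delta> G"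
  shows "\<tturnstile> add_mset (copies vs \<Delta>) G"
proof (cases vs)
  case Nil
  \<comment> \<open>With no copies the distinguished sequent is empty, so INIT and W
    suffice.\<close>
  then show ?thesis
    using derivable_weaken[OF derivable_INIT, of G] by simp
next
  case (Cons w ws)
  then show ?thesis
    using derivable_copies[OF assms, of vs] derivable_uncopy_all[of w ws G "{#copies vs \<Delta>#}"]
    by simp
qed

section \<open>Admissibility of M\<close>

text \<open>The vector is existential because, under \<open>rel_mset\<close>, every sequent of a
  hypersequent carries its own, possibly empty, one.\<close>

definition extends_by :: "'v sequent \<Rightarrow> 'v sequent \<Rightarrow> 'v sequent \<Rightarrow> bool" where
  "extends_by \<Delta> \<Gamma> \<Gamma>' \<longleftrightarrow> (\<exists>vs. \<Gamma>' = \<Gamma> + copies vs \<Delta>)"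

lemma rel_mset_add_extends_byE:
  assumes "rel_mset (extends_by \<Delta>) (add_mset \<Gamma> G) H"
  obtains vs G' where "H = add_mset (\<Gamma> + copies vs \<Delta>) G'" "rel_mset (extends_by \<Delta>) G G'"
  using assms by (metis extends_by_def msed_rel_invL)

lemma rel_mset_add_extends_byI:
  "rel_mset (extends_by \<Delta>) G G'
    \<Longrightarrow> rel_mset (extends_by \<Delta>) (add_mset \<Gamma> G) (add_mset (\<Gamma> + copies vs \<Delta>) G')"
  by (rule rel_mset_Plus) (auto simp: extends_by_def)

text \<open>Induction on the first derivation for all extensions \<open>H'\<close> at once, since S
  and T change the vectors between conclusion and premise. In the logical rules the copies of
  \<open>\<Delta>\<close> are just part of the context.\<close>

lemma derivable_extended:
  assumes "\<tturnstile> H" "\<tturnstile> add_mset \<Delta> G" "rel_mset (extends_by \<Delta>) H H'"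
  shows "\<tturnstile> H' + G"
  using assms(1,3)
proof (induction arbitrary: H' rule: derivable.induct)
  case (step \<rho> Hs H)
  note extI = rel_mset_add_extends_byI and extE = rel_mset_add_extends_byE
  have IH: "\<tturnstile> K' + G" if "K \<in> set Hs" "rel_mset (extends_by \<Delta>) K K'" for K K'
    using step.IH that by blast
  note rel = step.prems
  from step.hyps(1) show ?case
  proof cases
    case INIT
    then obtain vs where "H' = {#copies vs \<Delta>#}"
      \<comment> \<open>At a leaf only copies of \<open>\<Delta>\<close> remain; this is where the
        derivation of the second premise is plugged in.\<close>
      using rel by (auto elim!: extE)
    then show ?thesis
      using derivable_add_copies[OF assms(2), of vs] by simp
  next
    case (W K \<Gamma>)
    then obtain vs K' where H': "H' = add_mset (\<Gamma> + copies vs \<Delta>) K'"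
      and K': "rel_mset (extends_by \<Delta>) K K'"
      using rel by (auto elim: extE)
    then show ?thesis
      using IH[of K K'] W by (simp add: derivable_W)
  next
    case (C \<Gamma> K)
    then obtain vs K' where H': "H' = add_mset (\<Gamma> + copies vs \<Delta>) K'"
      and K': "rel_mset (extends_by \<Delta>) K K'"
      using rel by (auto elim: extE)
    \<comment> \<open>Both occurrences of \<open>\<Gamma>\<close> receive the same vector, so that C
      still applies.\<close>
    then show ?thesis
      using IH[OF _ extI[OF extI[OF K', of \<Gamma> vs], of \<Gamma> vs]] C
        derivable_C[of "\<Gamma> + copies vs \<Delta>" "K' + G"] by simp
  next
    case (S \<Gamma>1 \<Gamma>2 K)
    then obtain vs ws K' where H': "H' = add_mset (\<Gamma>1 + copies vs \<Delta>) (add_mset (\<Gamma>2 + copies ws \<Delta>) K')"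
      and K': "rel_mset (extends_by \<Delta>) K K'"
      using rel by (auto elim!: extE)
    then show ?thesis
      using IH[OF _ extI[OF K', of "\<Gamma>1 + \<Gamma>2" "vs @ ws"]] S
        derivable_S[of "\<Gamma>1 + copies vs \<Delta>" "\<Gamma>2 + copies ws \<Delta>" "K' + G"] by (simp add: ac_simps)
  next
    case (T r \<Gamma> K)
    then obtain vs K' where H': "H' = add_mset (\<Gamma> + copies vs \<Delta>) K'"
      and K': "rel_mset (extends_by \<Delta>) K K'"
      using rel by (auto elim: extE)
    then show ?thesis
      using IH[OF _ extI[OF K', of "scale_sequent r \<Gamma>" "map ((*) r) vs"]] T
        derivable_T[of r "\<Gamma> + copies vs \<Delta>" "K' + G"] by (simp add: copies_map_times)
  next
    case (ID rs ss \<Gamma> K x)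
    then obtain vs K' where
      H': "H' = add_mset (\<Gamma> + weigh rs (Var x) + weigh ss (NegVar x) + copies vs \<Delta>) K'"
      and K': "rel_mset (extends_by \<Delta>) K K'"
      using rel by (auto elim: extE)
    then show ?thesis
      using IH[OF _ extI[OF K', of \<Gamma> vs]] ID
        derivable_ID[of "\<Gamma> + copies vs \<Delta>" "K' + G" rs ss x] by (simp add: ac_simps)
  next
    case (zero \<Gamma> K rs)
    then obtain vs K' where H': "H' = add_mset (\<Gamma> + weigh rs Zero + copies vs \<Delta>) K'"
      and K': "rel_mset (extends_by \<Delta>) K K'"
      using rel by (auto elim: extE)
    then show ?thesis
      using IH[OF _ extI[OF K', of \<Gamma> vs]] zero
        derivable_zero[of "\<Gamma> + copies vs \<Delta>" "K' + G" rs] by (simp add: ac_simps)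
  next
    case (plus \<Gamma> rs A B K)
    then obtain vs K' where H': "H' = add_mset (\<Gamma> + weigh rs (Plus A B) + copies vs \<Delta>) K'"
      and K': "rel_mset (extends_by \<Delta>) K K'"
      using rel by (auto elim: extE)
    then show ?thesis
      using IH[OF _ extI[OF K', of "\<Gamma> + weigh rs A + weigh rs B" vs]] plus
        derivable_plus[of "\<Gamma> + copies vs \<Delta>" rs A B "K' + G"] by (simp add: ac_simps)
  next
    case (times \<Gamma> s rs A K)
    then obtain vs K' where H': "H' = add_mset (\<Gamma> + weigh rs (Scale s A) + copies vs \<Delta>) K'"
      and K': "rel_mset (extends_by \<Delta>) K K'"
      using rel by (auto elim: extE)
    then show ?thesis
      using IH[OF _ extI[OF K', of "\<Gamma> + weigh (map ((*) s) rs) A" vs]] times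
        derivable_times[of "\<Gamma> + copies vs \<Delta>" s rs A "K' + G"] by (simp add: ac_simps)
  next
    case (join \<Gamma> rs A B K)
    then obtain vs K' where H': "H' = add_mset (\<Gamma> + weigh rs (Join A B) + copies vs \<Delta>) K'"
      and K': "rel_mset (extends_by \<Delta>) K K'"
      using rel by (auto elim: extE)
    then show ?thesis
      using IH[OF _ extI[OF extI[OF K', of "\<Gamma> + weigh rs B" vs], of "\<Gamma> + weigh rs A" vs]] join
        derivable_join[of "\<Gamma> + copies vs \<Delta>" rs A B "K' + G"] by (simp add: ac_simps)
  next
    case (meet \<Gamma> rs A K B)
    then obtain vs K' where H': "H' = add_mset (\<Gamma> + weigh rs (Meet A B) + copies vs \<Delta>) K'"
      and K': "rel_mset (extends_by \<Delta>) K K'"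
      using rel by (auto elim: extE)
    then show ?thesis
      using IH[OF _ extI[OF K', of "\<Gamma> + weigh rs A" vs]] IH[OF _ extI[OF K', of "\<Gamma> + weigh rs B" vs]]
        meet derivable_meet[of "\<Gamma> + copies vs \<Delta>" rs A "K' + G" B] by (simp add: ac_simps)
  qed (use step.hyps(2) in auto)
qed

lemma derivable_M:
  assumes "\<tturnstile> add_mset \<Gamma> G" "\<tturnstile> add_mset \<Delta> G"
  shows "\<tturnstile> add_mset (\<Gamma> + \<Delta>) G"
proof -
  \<comment> \<open>The empty vector leaves the side hypersequent unchanged, while the vector
    \<open>[1]\<close> below adds exactly one \<open>\<Delta>\<close> to
    \<open>\<Gamma>\<close>.\<close>
  have "extends_by \<Delta> \<Gamma>' \<Gamma>'" for \<Gamma>'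
    unfolding extends_by_def by (rule exI[of _ "[]"]) simp
  then have "rel_mset (extends_by \<Delta>) G G"
    by (simp add: multiset.rel_refl)
  then have "rel_mset (extends_by \<Delta>) (add_mset \<Gamma> G) (add_mset (\<Gamma> + \<Delta>) G)"
    using rel_mset_add_extends_byI[of \<Delta> G G \<Gamma> "[1]"] by simp
  \<comment> \<open>One \<open>G\<close> comes from each derivation; contraction removes the
    duplicate.\<close>
  then have "\<tturnstile> add_mset (\<Gamma> + \<Delta>) G + G"
    using derivable_extended assms by blast
  then show ?thesis
    using derivable_contract[of G "{#\<Gamma> + \<Delta>#}"] by simp
qed

text \<open>Instances of M are removed from the leaves downwards: by induction the premises are
  already M-free derivable when \<open>derivable_M\<close> is applied.\<close>

lemma M_elimination: "derivable {R_CAN} H \<Longrightarrow> \<tturnstile> H"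
proof (induction rule: derivable.induct)
  case (step \<rho> Hs H)
  show ?case
  proof (cases "\<rho> = R_M")
    case True
    with step.hyps(1) obtain \<Gamma>1 \<Gamma>2 G
      where "Hs = [add_mset \<Gamma>1 G, add_mset \<Gamma>2 G]" "H = add_mset (\<Gamma>1 + \<Gamma>2) G"
      by (auto elim: rule_instance.cases)
    then show ?thesis
      using step.IH by (simp add: derivable_M)
  next
    case False
    then show ?thesis
      using step by (intro derivable.step[OF step.hyps(1)]) auto
  qed
qed

theorem theorem3p12:
  fixes H :: "('v :: countable) hypersequent"
  assumes "\<exists>d. derivation d \<and> conclusion d = H \<and> CAN_free d"
  shows "\<exists>d. derivation d \<and> conclusion d = H \<and> CAN_free d \<and> M_free d"
proof -
  have "derivable {R_CAN} H"
    using assms by (auto simp: derivable_iff CAN_free_def)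
  then have "\<tturnstile> H"
    by (rule M_elimination)
  then show ?thesis
    by (auto simp: derivable_iff CAN_free_def M_free_def)
qed

end
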